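(* Let $(E,\mu)$ be a measure space and let $f$ and $g$ be two real-valued, measurable functions on $E$, finite $\mu$-a.e. Then, for all $t>0$: $$(f\,g)^{\star\star}(t)\;\leq\;\frac{2}{t}\int_0^t f^\#(s)\,g^\#(s)\,ds\;\leq\;\frac{2}{t}\int_0^t f^{\star\star}(s)\,g^{\star\star}(s)\,ds .$$
   Context: For a real-valued, measurable, $\mu$-a.e. finite function $f$ on a measure space $(E,\mu)$: - the distribution function is $\mu_f(\lambda)=\mu(\{x\in E : |f(x)|>\lambda\})$ for $\lambda\geq 0$; - the decreasing rearrangement is $f^\#(t)=\inf\{\lambda>0 : \mu_f(\lambda)\leq t\}$ for $t>0$, with $\inf\emptyset=+\infty$; - the maximal function is $f^{\star\star}(t)=\frac{1}{t}\int_0^t f^\#(s)\,ds$ for $t>0$. All these quantities and integrals take values in $[0,+\infty]$, with the usual measure-theoretic convention $0\cdot\infty=0$. *)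

theory Defs
  imports "HOL-Analysis.Analysis"
begin

text \<open>
  Functions take values in \<^typ>\<open>ereal\<close>, so that ``finite almost everywhere'' is a meaningful
  hypothesis; everywhere real-valued functions are the special case \<open>\<lambda>x. ereal (f x)\<close>.
  In both \<^typ>\<open>ereal\<close> and \<^typ>\<open>ennreal\<close> one has \<open>0 * \<infinity> = 0\<close>.
\<close>

definition distribution_function :: "'a measure \<Rightarrow> ('a \<Rightarrow> ereal) \<Rightarrow> real \<Rightarrow> ennreal" where
  "distribution_function M f l = emeasure M {x \<in> space M. \<bar>f x\<bar> > ereal l}"

text \<open>The infimum is taken in \<^typ>\<open>ennreal\<close>, where \<open>Inf {} = \<infinity>\<close>.\<close>

definition decreasing_rearrangement :: "'a measure \<Rightarrow> ('a \<Rightarrow> ereal) \<Rightarrow> real \<Rightarrow> ennreal" where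
  "decreasing_rearrangement M f t =
     Inf {ennreal l | l. l > 0 \<and> distribution_function M f l \<le> ennreal t}"

definition maximal_function :: "'a measure \<Rightarrow> ('a \<Rightarrow> ereal) \<Rightarrow> real \<Rightarrow> ennreal" where
  "maximal_function M f t =
     ennreal (1 / t) * (\<integral>\<^sup>+ s\<in>{0<..<t}. decreasing_rearrangement M f s \<partial>lborel)"

end

(*
  Splitting the level set {|fg| > ab} into {|f| > a} and {|g| > b} gives
  (fg)#(u + v) <= f#(u) g#(v). Taking u = v = s/2, integrating over (0,t) and substituting
  yields the first inequality, the factor 2 being the Jacobian. The second one is
  pointwise: f# decreases, so it lies below its running mean.

  The product bound is delicate only when one factor is 0 and the other infinite, as
  0 * \<infinity> = 0: then continuity from below gives mu {|f| > 0} <= u, hence (fg)#(u + v) = 0.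
*)
theory Submission imports Defs begin

text \<open>A larger argument admits more levels into the infimum. Negative arguments cause no
  exception, since \<open>ennreal\<close> sends them to 0.\<close>

lemma antimono_decreasing_rearrangement: "antimono (decreasing_rearrangement M f)"
proof (rule antimonoI)
  fix s t :: real
  assume "s \<le> t"
  then have "ennreal s \<le> ennreal t"
    by (rule ennreal_leI)
  then show "decreasing_rearrangement M f t \<le> decreasing_rearrangement M f s"
    unfolding decreasing_rearrangement_def by (intro Inf_superset_mono) (auto intro: order_trans)
qed

text \<open>Superlevel sets of a decreasing function are intervals. Measurability is what the affine
  substitution in the integral will require.\<close>

lemma borel_measurable_antimono_ennreal:
  fixes h :: "real \<Rightarrow> ennreal"
  assumes "antimono h"
  shows "h \<in> borel_measurable borel"
proof (rule borel_measurableI_greater)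
  fix y
  have "is_interval {s. y < h s}"
    unfolding is_interval_1 using antimonoD[OF assms] by (auto intro: less_le_trans)
  then show "{s \<in> space borel. y < h s} \<in> sets borel"
    using real_interval_borel_measurable by simp
qed

lemma borel_measurable_decreasing_rearrangement [measurable]:
  "decreasing_rearrangement M f \<in> borel_measurable borel"
  by (rule borel_measurable_antimono_ennreal[OF antimono_decreasing_rearrangement])

lemma antimono_distribution_function:
  assumes [measurable]: "f \<in> borel_measurable M"
    and "k \<le> l"
  shows "distribution_function M f l \<le> distribution_function M f k"
  unfolding distribution_function_def
proof (rule emeasure_mono)
  show "{x \<in> space M. ereal l < \<bar>f x\<bar>} \<subseteq> {x \<in> space M. ereal k < \<bar>f x\<bar>}"
    using \<open>k \<le> l\<close> by (auto intro: le_less_trans[of "ereal k" "ereal l"])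
qed measurable

text \<open>Strictness yields an admissible level \<open>k\<close> below \<open>l\<close>, whether
  or not the infimum is attained; monotonicity then passes from \<open>k\<close> to
  \<open>l\<close>.\<close>

lemma distribution_function_le_if_rearrangement_less:
  assumes "f \<in> borel_measurable M"
    and "decreasing_rearrangement M f t < ennreal l"
  shows "distribution_function M f l \<le> ennreal t"
proof -
  obtain k where k: "k > 0" "distribution_function M f k \<le> ennreal t" "ennreal k < ennreal l"
    using assms(2) unfolding decreasing_rearrangement_def Inf_less_iff by blast
  then have "k \<le> l"
    by (meson ennreal_leI leD le_cases)
  then show ?thesis
    using antimono_distribution_function[OF assms(1)] k(2) order_trans by blast
qed

text \<open>Level 0 is excluded from the infimum, so it is reached as a limit: {|f| > 0} is the
  increasing union of the level sets at 1/(n+1), each of measure at most \<open>t\<close>.\<close>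

lemma distribution_function_zero_le:
  assumes f [measurable]: "f \<in> borel_measurable M"
    and "decreasing_rearrangement M f t = 0"
  shows "distribution_function M f 0 \<le> ennreal t"
proof -
  let ?A = "\<lambda>n::nat. {x \<in> space M. ereal (1 / Suc n) < \<bar>f x\<bar>}"
  have "incseq ?A"
  proof (intro monoI subsetI)
    fix m n :: nat and x
    assume "m \<le> n" "x \<in> ?A m"
    moreover have "ereal (1 / Suc n) \<le> ereal (1 / Suc m)"
      using \<open>m \<le> n\<close> by (simp add: frac_le)
    ultimately show "x \<in> ?A n"
      using le_less_trans by (metis (mono_tags, lifting) mem_Collect_eq)
  qed
  moreover have "range ?A \<subseteq> sets M"
    by auto
  ultimately have "(SUP n. emeasure M (?A n)) = emeasure M (\<Union>n. ?A n)"
    by (intro SUP_emeasure_incseq)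
  also have "(\<Union>n. ?A n) = {x \<in> space M. ereal 0 < \<bar>f x\<bar>}"
  proof (intro set_eqI iffI)
    fix x
    assume x: "x \<in> {x \<in> space M. ereal 0 < \<bar>f x\<bar>}"
    \<comment> \<open>As |f x| may be infinite, a real number is interposed before the Archimedean
      property is applied.\<close>
    then obtain r where r: "0 < r" "ereal r < \<bar>f x\<bar>"
      using ereal_dense2[of "ereal 0" "\<bar>f x\<bar>"] by auto
    obtain n where "1 / Suc n < r"
      using nat_approx_posE[OF r(1)] by blast
    then have "ereal (1 / Suc n) < \<bar>f x\<bar>"
      using r(2) less_trans[of "ereal (1 / Suc n)" "ereal r" "\<bar>f x\<bar>"] by simp
    then show "x \<in> (\<Union>n. ?A n)"
      using x by auto
  next
    fix x
    assume "x \<in> (\<Union>n. ?A n)"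
    then obtain n where n: "x \<in> space M" "ereal (1 / Suc n) < \<bar>f x\<bar>"
      by blast
    have "ereal 0 < ereal (1 / Suc n)"
      by simp
    then show "x \<in> {x \<in> space M. ereal 0 < \<bar>f x\<bar>}"
      using n less_trans by blast
  qed
  finally have "distribution_function M f 0 = (SUP n. distribution_function M f (1 / Suc n))"
    by (simp add: distribution_function_def)
  also have "\<dots> \<le> ennreal t"
    using assms(2)
    by (intro SUP_least distribution_function_le_if_rearrangement_less[OF f]) simp
  finally show ?thesis .
qed

text \<open>The product vanishes wherever \<open>f\<close> does, even where \<open>g\<close> is
  infinite. So every level set of the product at \<open>e\<close> > 0 lies in {|f| > 0}, and every
  such \<open>e\<close> is admissible.\<close>

lemma rearrangement_mult_eq_0:
  assumes f [measurable]: "f \<in> borel_measurable M"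
    and [measurable]: "g \<in> borel_measurable M"
    and zero: "decreasing_rearrangement M f u = 0"
    and "u \<le> s"
  shows "decreasing_rearrangement M (\<lambda>x. f x * g x) s = 0"
proof -
  have small: "decreasing_rearrangement M (\<lambda>x. f x * g x) s \<le> ennreal e" if "0 < e" for e
  proof -
    have "distribution_function M (\<lambda>x. f x * g x) e \<le> distribution_function M f 0"
      unfolding distribution_function_def
    proof (rule emeasure_mono)
      have "ereal 0 < \<bar>f x\<bar>" if "ereal e < \<bar>f x * g x\<bar>" for x
        using that \<open>0 < e\<close> by (cases "f x") (auto simp flip: zero_ereal_def)
      then show "{x \<in> space M. ereal e < \<bar>f x * g x\<bar>} \<subseteq> {x \<in> space M. ereal 0 < \<bar>f x\<bar>}"
        by blast
    qed measurable
    also have "\<dots> \<le> ennreal s"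
      using distribution_function_zero_le[OF f zero] ennreal_leI[OF \<open>u \<le> s\<close>] by (rule order_trans)
    finally show ?thesis
      unfolding decreasing_rearrangement_def using that by (intro Inf_lower) auto
  qed
  have "decreasing_rearrangement M (\<lambda>x. f x * g x) s \<le> 0"
    by (rule ennreal_le_epsilon) (simp add: small)
  then show ?thesis
    by simp
qed

lemma distribution_function_mult_le:
  assumes [measurable]: "f \<in> borel_measurable M" "g \<in> borel_measurable M"
    and "0 < a" "0 < b"
  shows "distribution_function M (\<lambda>x. f x * g x) (a * b)
    \<le> distribution_function M f a + distribution_function M g b"
proof -
  have "ereal a < \<bar>f x\<bar> \<or> ereal b < \<bar>g x\<bar>" if "ereal (a * b) < \<bar>f x * g x\<bar>" for x
  proof (rule ccontr)
    assume "\<not> ?thesis"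
    then have "\<bar>f x\<bar> * \<bar>g x\<bar> \<le> ereal a * ereal b"
      using \<open>0 < a\<close> by (intro ereal_mult_mono) auto
    then show False
      using that by (simp add: ereal_abs_mult leD)
  qed
  then have "distribution_function M (\<lambda>x. f x * g x) (a * b)
      \<le> emeasure M ({x \<in> space M. ereal a < \<bar>f x\<bar>} \<union> {x \<in> space M. ereal b < \<bar>g x\<bar>})"
    unfolding distribution_function_def by (intro emeasure_mono) auto
  also have "\<dots> \<le> distribution_function M f a + distribution_function M g b"
    unfolding distribution_function_def by (intro emeasure_subadditive) measurable
  finally show ?thesis .
qed

text \<open>Division by \<open>c\<close> makes x / c a lower bound of \<open>B\<close>. Both
  restrictions on \<open>c\<close> matter: an empty \<open>B\<close> refutes the claim for 0, a set
  of positive numbers with infimum 0 refutes it for \<open>top\<close>.\<close>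

lemma le_mult_Inf_ennreal:
  fixes x c :: ennreal
  assumes "\<And>b. b \<in> B \<Longrightarrow> x \<le> c * b"
    and "c \<noteq> 0" "c \<noteq> top"
  shows "x \<le> c * Inf B"
proof -
  have "x / c \<le> Inf B"
    using assms by (intro Inf_greatest divide_le_posI_ennreal) (auto simp: mult.commute zero_less_iff_neq_zero)
  then show ?thesis
    using assms(2,3) mult_left_mono[of "x / c" "Inf B" c]
    by (simp add: ennreal_times_divide ennreal_mult_divide_eq mult.commute[of c x])
qed

lemma rearrangement_mult_le:
  assumes f: "f \<in> borel_measurable M" and g: "g \<in> borel_measurable M"
    and "0 \<le> u" "0 \<le> v"
  shows "decreasing_rearrangement M (\<lambda>x. f x * g x) (u + v)
    \<le> decreasing_rearrangement M f u * decreasing_rearrangement M g v"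
    (is "?h \<le> ?F * ?G")
proof -
  \<comment> \<open>The zero cases cover the product of 0 and \<open>top\<close>. In the third case
    the right-hand side is \<open>top\<close>; only the last one needs the level sets.\<close>
  consider "?F = 0" | "?G = 0" | "?F \<noteq> 0" "?G \<noteq> 0" "?F = top \<or> ?G = top"
    | "?G \<noteq> 0" "?F \<noteq> top" "?G \<noteq> top"
    by blast
  then show ?thesis
  proof cases
    case 1
    then show ?thesis
      using rearrangement_mult_eq_0[OF f g 1] \<open>0 \<le> v\<close> by simp
  next
    case 2
    then show ?thesis
      using rearrangement_mult_eq_0[OF g f 2, of "u + v"] \<open>0 \<le> u\<close> by (simp add: mult.commute)
  next
    case 3
    then show ?thesis
      by (auto simp: ennreal_top_mult ennreal_mult_top)
  next
    case 4
    let ?A = "{ennreal a | a. a > 0 \<and> distribution_function M f a \<le> ennreal u}"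
    let ?B = "{ennreal b | b. b > 0 \<and> distribution_function M g b \<le> ennreal v}"
    have "?h \<le> a * b" if ab: "a \<in> ?A" "b \<in> ?B" for a b
    proof -
      obtain k l where a: "a = ennreal k" "0 < k" "distribution_function M f k \<le> ennreal u"
        and b: "b = ennreal l" "0 < l" "distribution_function M g l \<le> ennreal v"
        using ab by blast
      have "distribution_function M (\<lambda>x. f x * g x) (k * l) \<le> ennreal (u + v)"
        using distribution_function_mult_le[OF f g \<open>0 < k\<close> \<open>0 < l\<close>] add_mono[OF a(3) b(3)]
          \<open>0 \<le> u\<close> \<open>0 \<le> v\<close> by (simp add: ennreal_plus)
      moreover have "a * b = ennreal (k * l)"
        using a b by (simp add: ennreal_mult)
      ultimately show ?thesis
        unfolding decreasing_rearrangement_def using a(2) b(2) by (intro Inf_lower) auto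
    qed
    \<comment> \<open>The two infima are taken one after the other. Here the multiplier
      \<open>a\<close> is a positive real; in the second passage it is \<open>?G\<close>, nonzero
      and finite by the case assumption.\<close>
    then have "?h \<le> a * Inf ?B" if "a \<in> ?A" for a
      using that by (intro le_mult_Inf_ennreal) auto
    then have "?h \<le> ?G * a" if "a \<in> ?A" for a
      using that by (simp add: decreasing_rearrangement_def mult.commute)
    then have "?h \<le> ?G * Inf ?A"
      using 4 by (intro le_mult_Inf_ennreal) auto
    then show ?thesis
      by (simp add: decreasing_rearrangement_def mult.commute)
  qed
qed

lemma rearrangement_le_maximal_function:
  assumes "0 < t"
  shows "decreasing_rearrangement M f t \<le> maximal_function M f t"
proof -
  let ?c = "decreasing_rearrangement M f t"
  \<comment> \<open>The constant \<open>?c\<close> is written as its own mean over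
    \<open>{0<..<t}\<close>, to be compared there with the larger values at s < t.\<close>
  have "?c = ennreal (1 / t) * (?c * ennreal t)"
    using assms by (simp add: mult.left_commute ennreal_mult[symmetric])
  also have "?c * ennreal t = (\<integral>\<^sup>+ s\<in>{0<..<t}. ?c \<partial>lborel)"
    using assms by (simp add: nn_integral_cmult_indicator)
  also have "\<dots> \<le> (\<integral>\<^sup>+ s\<in>{0<..<t}. decreasing_rearrangement M f s \<partial>lborel)"
    using antimonoD[OF antimono_decreasing_rearrangement, of _ t M f]
    by (intro nn_integral_mono) (auto simp: indicator_def)
  finally show ?thesis
    unfolding maximal_function_def by (simp add: mult_left_mono)
qed

lemma nn_integral_rearrangement_mult_le:
  assumes f: "f \<in> borel_measurable M" and g: "g \<in> borel_measurable M"
  shows "(\<integral>\<^sup>+ s\<in>{0<..<t}. decreasing_rearrangement M (\<lambda>x. f x * g x) s \<partial>lborel)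
    \<le> 2 * (\<integral>\<^sup>+ s\<in>{0<..<t}. (decreasing_rearrangement M f s * decreasing_rearrangement M g s) \<partial>lborel)"
proof -
  let ?p = "\<lambda>s. decreasing_rearrangement M f s * decreasing_rearrangement M g s * indicator {0<..<t} s"
  \<comment> \<open>The indicator inside \<open>?p\<close> at s/2 is that of (0, 2t) in s. It
    contains (0, t), so the bound is pointwise, and after substitution the integral runs over (0, t)
    again.\<close>
  have "(\<integral>\<^sup>+ s\<in>{0<..<t}. decreasing_rearrangement M (\<lambda>x. f x * g x) s \<partial>lborel)
      \<le> (\<integral>\<^sup>+ s. ?p (0 + 1 / 2 * s) \<partial>lborel)"
  proof (rule nn_integral_mono)
    fix s
    show "decreasing_rearrangement M (\<lambda>x. f x * g x) s * indicator {0<..<t} s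
        \<le> ?p (0 + 1 / 2 * s)"
      using rearrangement_mult_le[OF f g, of "s / 2" "s / 2"] by (auto simp: indicator_def)
  qed
  \<comment> \<open>Inserting 2 * (1/2) = 1 gives the integral the shape of the affine change of
    variables with slope 1/2.\<close>
  also have "\<dots> = 2 * (ennreal \<bar>1 / 2\<bar> * (\<integral>\<^sup>+ s. ?p (0 + 1 / 2 * s) \<partial>lborel))"
  proof -
    have "2 * ennreal \<bar>1 / 2\<bar> = 1"
      using ennreal_mult[of 2 "\<bar>1 / 2\<bar>"] by simp
    then show ?thesis
      by (simp only: mult.assoc[symmetric] mult_1_left)
  qed
  also have "ennreal \<bar>1 / 2\<bar> * (\<integral>\<^sup>+ s. ?p (0 + 1 / 2 * s) \<partial>lborel) = (\<integral>\<^sup>+ s. ?p s \<partial>lborel)"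
    by (rule nn_integral_real_affine[symmetric]) auto
  finally show ?thesis .
qed

theorem mainTheorem2:
  fixes M :: "'a measure" and f g :: "'a \<Rightarrow> ereal" and t :: real
  assumes "f \<in> borel_measurable M" and "g \<in> borel_measurable M"
    and "AE x in M. \<bar>f x\<bar> < \<infinity>" and "AE x in M. \<bar>g x\<bar> < \<infinity>"
    and "t > 0"
  shows "maximal_function M (\<lambda>x. f x * g x) t
           \<le> ennreal (2 / t) *
              (\<integral>\<^sup>+ s\<in>{0<..<t}. (decreasing_rearrangement M f s * decreasing_rearrangement M g s) \<partial>lborel)
       \<and> ennreal (2 / t) *
              (\<integral>\<^sup>+ s\<in>{0<..<t}. (decreasing_rearrangement M f s * decreasing_rearrangement M g s) \<partial>lborel)
           \<le> ennreal (2 / t) *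
              (\<integral>\<^sup>+ s\<in>{0<..<t}. (maximal_function M f s * maximal_function M g s) \<partial>lborel)"
proof (intro conjI mult_left_mono)
  \<comment> \<open>The factor 1/t comes from the mean, the 2 from the substitution.\<close>
  have "ennreal (2 / t) = ennreal (1 / t) * 2"
    using \<open>t > 0\<close> by (simp add: ennreal_mult[symmetric] flip: ennreal_numeral)
  then show "maximal_function M (\<lambda>x. f x * g x) t
      \<le> ennreal (2 / t) *
        (\<integral>\<^sup>+ s\<in>{0<..<t}. (decreasing_rearrangement M f s * decreasing_rearrangement M g s) \<partial>lborel)"
    using nn_integral_rearrangement_mult_le[OF assms(1,2), of t]
    by (simp add: maximal_function_def mult.assoc mult_left_mono)
next
  show "(\<integral>\<^sup>+ s\<in>{0<..<t}. (decreasing_rearrangement M f s * decreasing_rearrangement M g s) \<partial>lborel)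
      \<le> (\<integral>\<^sup>+ s\<in>{0<..<t}. (maximal_function M f s * maximal_function M g s) \<partial>lborel)"
    by (intro nn_integral_mono)
      (auto simp: indicator_def intro!: mult_mono rearrangement_le_maximal_function)
qed simp

end
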